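(* Let $\Sigma_5=\{\mathtt{a},\mathtt{b},\mathtt{c},\mathtt{d},\mathtt{e}\}$ and let $w_5=G(F^\omega(\mathtt{0}))$, where $F:\{\mathtt{0},\mathtt{1},\mathtt{2},\mathtt{3},\mathtt{4}\}^*\to\{\mathtt{0},\mathtt{1},\mathtt{2},\mathtt{3},\mathtt{4}\}^*$ is the morphism $F(\mathtt{0})=\mathtt{01}$, $F(\mathtt{1})=\mathtt{2}$, $F(\mathtt{2})=\mathtt{03}$, $F(\mathtt{3})=\mathtt{24}$, $F(\mathtt{4})=\mathtt{23}$, and $G:\{\mathtt{0},\ldots,\mathtt{4}\}^*\to\Sigma_5^*$ is the morphism $G(\mathtt{0})=\mathtt{abcd}$, $G(\mathtt{1})=\varepsilon$, $G(\mathtt{2})=\mathtt{eacd}$, $G(\mathtt{3})=\mathtt{becd}$, $G(\mathtt{4})=\mathtt{be}$. Then the infinite word $w_5$ avoids every conjugacy class of length at least $2$: for every finite word $u$ with $|u|\ge 2$, there is a conjugate (cyclic permutation) of $u$ that is not a factor of $w_5$.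
   Context: $\varepsilon$ denotes the empty word. $F^\omega(\mathtt{0})$ is the infinite fixed point of $F$ starting with $\mathtt{0}$ (the limit of $F^n(\mathtt{0})$), and $G$ is applied to it letter by letter. A conjugate of a word $u=xy$ is a word $yx$. A word contains (does not avoid) the conjugacy class of $u$ if every conjugate of $u$ is a factor of it. *)

theory Defs
  imports "HOL-Library.Stream" "HOL-Library.Sublist"
begin

text \<open>Finite words are lists, infinite words are streams. A morphism of free monoids is
  given by its values on letters.\<close>

definition morphism :: "('a \<Rightarrow> 'b list) \<Rightarrow> 'a list \<Rightarrow> 'b list" where
  "morphism f w = concat (map f w)"

text \<open>Convergence of finite words to an infinite word: every prefix of the limit is
  eventually a prefix of the members of the sequence.\<close>

definition word_converges :: "(nat \<Rightarrow> 'a list) \<Rightarrow> 'a stream \<Rightarrow> bool" where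
  "word_converges X s \<longleftrightarrow> (\<forall>k. \<exists>N. \<forall>n\<ge>N. prefix (stake k s) (X n))"

definition word_limit :: "(nat \<Rightarrow> 'a list) \<Rightarrow> 'a stream" where
  "word_limit X = (THE s. word_converges X s)"

text \<open>Letter-by-letter image of an infinite word. Letters may be erased, so this is meaningful
  only if infinitely many letters have a nonempty image.\<close>

definition morphism_stream :: "('a \<Rightarrow> 'b list) \<Rightarrow> 'a stream \<Rightarrow> 'b stream" where
  "morphism_stream f s = word_limit (\<lambda>n. morphism f (stake n s))"

definition conjugate :: "'a list \<Rightarrow> 'a list \<Rightarrow> bool" where
  "conjugate u v \<longleftrightarrow> (\<exists>x y. u = x @ y \<and> v = y @ x)"

definition factor :: "'a list \<Rightarrow> 'a stream \<Rightarrow> bool" where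
  "factor u s \<longleftrightarrow> (\<exists>p t. s = p @- u @- t)"

definition contains_conjugacy_class :: "'a stream \<Rightarrow> 'a list \<Rightarrow> bool" where
  "contains_conjugacy_class s u \<longleftrightarrow> (\<forall>v. conjugate u v \<longrightarrow> factor v s)"

definition avoids_conjugacy_class :: "'a stream \<Rightarrow> 'a list \<Rightarrow> bool" where
  "avoids_conjugacy_class s u \<longleftrightarrow> \<not> contains_conjugacy_class s u"

datatype digit = D0 | D1 | D2 | D3 | D4

datatype letter = La | Lb | Lc | Ld | Le

fun F_letter :: "digit \<Rightarrow> digit list" where
  "F_letter D0 = [D0, D1]"
| "F_letter D1 = [D2]"
| "F_letter D2 = [D0, D3]"
| "F_letter D3 = [D2, D4]"
| "F_letter D4 = [D2, D3]"

fun G_letter :: "digit \<Rightarrow> letter list" where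
  "G_letter D0 = [La, Lb, Lc, Ld]"
| "G_letter D1 = []"
| "G_letter D2 = [Le, La, Lc, Ld]"
| "G_letter D3 = [Lb, Le, Lc, Ld]"
| "G_letter D4 = [Lb, Le]"

definition F_omega :: "digit stream" where
  "F_omega = word_limit (\<lambda>n. (morphism F_letter ^^ n) [D0])"

definition w5 :: "letter stream" where
  "w5 = morphism_stream G_letter F_omega"

text \<open>The limits above exist: \<open>F_omega\<close> and \<open>w5\<close> are genuine limits, and \<open>F_omega\<close> is a fixed
  point.\<close>

lemma word_converges_unique:
  assumes "word_converges X s" "word_converges X t"
  shows "s = t"
proof -
  have "s !! k = t !! k" for k
  proof -
    obtain M N where M: "\<forall>n\<ge>M. prefix (stake (Suc k) s) (X n)"
      and N: "\<forall>n\<ge>N. prefix (stake (Suc k) t) (X n)"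
      using assms unfolding word_converges_def by blast
    have p: "prefix (stake (Suc k) s) (X (max M N))"
      using M by (metis max.cobounded1)
    have q: "prefix (stake (Suc k) t) (X (max M N))"
      using N by (metis max.cobounded2)
    have "stake (Suc k) s = stake (Suc k) t"
      using p q by (metis length_stake append_eq_append_conv prefixE)
    then show ?thesis by (metis lessI stake_nth)
  qed
  then show ?thesis using smap_alt[of id s t] by (simp add: stream.map_id)
qed

lemma word_limitI: "word_converges X s \<Longrightarrow> word_limit X = s"
  unfolding word_limit_def by (blast intro: the_equality word_converges_unique)

lemma word_converges_chain:
  assumes chain: "\<And>n. prefix (X n) (X (Suc n))" and long: "\<And>k. \<exists>n. k \<le> length (X n)"
  shows "word_converges X (word_limit X)"
proof -
  have mono: "prefix (X m) (X n)" if "m \<le> n" for m n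
    using that by (induction rule: dec_induct) (auto intro: chain prefix_order.trans)
  obtain N where N: "\<And>k. k \<le> length (X (N k))" using long by metis
  define s where "s = smap (\<lambda>i. X (N (Suc i)) ! i) (fromN 0)"
  have nth: "X n ! i = s !! i" if "i < length (X n)" for n i
  proof -
    have i: "i < length (X (N (Suc i)))" using N[of "Suc i"] by simp
    have "prefix (X n) (X (N (Suc i))) \<or> prefix (X (N (Suc i))) (X n)"
      using mono nat_le_linear by blast
    then have "X n ! i = X (N (Suc i)) ! i"
      using that i by (metis nth_append prefixE)
    then show ?thesis by (simp add: s_def)
  qed
  have "word_converges X s"
    unfolding word_converges_def
  proof (intro allI exI impI)
    fix k n assume "N k \<le> n"
    then have len: "k \<le> length (X n)"
      using N[of k] mono[of "N k" n] prefix_length_le by fastforce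
    have "stake k s = take k (X n)"
      using len by (intro nth_equalityI) (auto simp: nth)
    then show "prefix (stake k s) (X n)" by (simp add: take_is_prefix)
  qed
  then show ?thesis using word_limitI by metis
qed

lemma morphism_simps [simp]:
  "morphism f [] = []"
  "morphism f (x # xs) = f x @ morphism f xs"
  "morphism f (xs @ ys) = morphism f xs @ morphism f ys"
  by (simp_all add: morphism_def)

lemma morphism_prefix: "prefix u v \<Longrightarrow> prefix (morphism f u) (morphism f v)"
  by (auto elim!: prefixE)

lemma F_pow_append:
  "(morphism F_letter ^^ n) (xs @ ys) = (morphism F_letter ^^ n) xs @ (morphism F_letter ^^ n) ys"
  by (induction n) auto

lemma F_pow_Suc:
  "(morphism F_letter ^^ Suc n) [D0] = (morphism F_letter ^^ n) [D0] @ (morphism F_letter ^^ n) [D1]"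
  using F_pow_append[of n "[D0]" "[D1]"] by (simp add: funpow_swap1)

lemma F_pow_D1_nonempty: "(morphism F_letter ^^ n) [D1] \<noteq> []"
proof (induction n)
  case (Suc n)
  then obtain x xs where "(morphism F_letter ^^ n) [D1] = x # xs" by (meson list.exhaust)
  then show ?case by (cases x) auto
qed simp

lemma G_F_pow_D1_nonempty:
  assumes "n > 0"
  shows "morphism G_letter ((morphism F_letter ^^ n) [D1]) \<noteq> []"
proof -
  have "\<exists>xs. (morphism F_letter ^^ Suc m) [D1] = D0 # xs
      \<or> (morphism F_letter ^^ Suc m) [D1] = D2 # xs" for m
    by (induction m) auto
  then show ?thesis using assms
    by (metis gr0_conv_Suc morphism_simps(2) G_letter.simps(1,3) append_Cons list.distinct(1))
qed

lemma F_omega_converges: "word_converges (\<lambda>n. (morphism F_letter ^^ n) [D0]) F_omega"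
  unfolding F_omega_def
proof (rule word_converges_chain)
  show "prefix ((morphism F_letter ^^ n) [D0]) ((morphism F_letter ^^ Suc n) [D0])" for n
    unfolding F_pow_Suc by simp
  have "n \<le> length ((morphism F_letter ^^ n) [D0])" for n
  proof (induction n)
    case (Suc n)
    have "length ((morphism F_letter ^^ n) [D1]) > 0" using F_pow_D1_nonempty by blast
    then show ?case using Suc unfolding F_pow_Suc length_append by linarith
  qed simp
  then show "\<exists>n. k \<le> length ((morphism F_letter ^^ n) [D0])" for k by blast
qed

lemma F_pow_prefix_F_omega: "\<exists>k. (morphism F_letter ^^ n) [D0] = stake k F_omega"
proof -
  let ?X = "\<lambda>n. (morphism F_letter ^^ n) [D0]"
  have mono: "prefix (?X m) (?X n)" if "m \<le> n" for m n
    using that by (induction rule: dec_induct) (auto simp: F_pow_Suc simp del: funpow.simps)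
  obtain N where N: "\<forall>m\<ge>N. prefix (stake (length (?X n)) F_omega) (?X m)"
    using F_omega_converges unfolding word_converges_def by blast
  have "prefix (stake (length (?X n)) F_omega) (?X (max N n))" using N by simp
  moreover have "prefix (?X n) (?X (max N n))" by (simp add: mono)
  ultimately have "?X n = stake (length (?X n)) F_omega"
    by (metis append_eq_append_conv length_stake prefixE)
  then show ?thesis by blast
qed

lemma stake_prefix: "m \<le> n \<Longrightarrow> prefix (stake m s) (stake n s)"
  by (metis le_add_diff_inverse prefixI stake_add)

lemma morphism_stream_F_omega_converges:
  assumes long: "\<And>k. \<exists>n. k \<le> length (morphism f ((morphism F_letter ^^ n) [D0]))"
  shows "word_converges (\<lambda>n. morphism f (stake n F_omega)) (morphism_stream f F_omega)"
  unfolding morphism_stream_def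
proof (rule word_converges_chain)
  show "prefix (morphism f (stake n F_omega)) (morphism f (stake (Suc n) F_omega))" for n
    by (intro morphism_prefix stake_prefix) simp
  show "\<exists>n. k \<le> length (morphism f (stake n F_omega))" for k
    using long[of k] F_pow_prefix_F_omega by metis
qed

lemma w5_converges: "word_converges (\<lambda>n. morphism G_letter (stake n F_omega)) w5"
  unfolding w5_def
proof (rule morphism_stream_F_omega_converges)
  have "n \<le> length (morphism G_letter ((morphism F_letter ^^ n) [D0]))" for n
  proof (induction n)
    case (Suc n)
    show ?case
    proof (cases "n = 0")
      case False
      then have "length (morphism G_letter ((morphism F_letter ^^ n) [D1])) > 0"
        using G_F_pow_D1_nonempty by blast
      then show ?thesis using Suc unfolding F_pow_Suc morphism_simps length_append by linarith
    qed simp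
  qed simp
  then show "\<exists>n. k \<le> length (morphism G_letter ((morphism F_letter ^^ n) [D0]))" for k by blast
qed

lemma F_omega_fixed_point: "morphism_stream F_letter F_omega = F_omega"
proof -
  let ?X = "\<lambda>n. (morphism F_letter ^^ n) [D0]"
  have "word_converges (\<lambda>n. morphism F_letter (stake n F_omega)) F_omega"
    unfolding word_converges_def
  proof
    fix k
    obtain N where "\<forall>n\<ge>N. prefix (stake k F_omega) (?X n)"
      using F_omega_converges unfolding word_converges_def by blast
    then have p: "prefix (stake k F_omega) (?X (Suc N))" by (meson le_SucI order_refl)
    obtain M where M: "?X N = stake M F_omega" using F_pow_prefix_F_omega by blast
    have "prefix (stake k F_omega) (morphism F_letter (stake n F_omega))" if "M \<le> n" for n
      using p morphism_prefix[OF stake_prefix[OF that]] M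
      by (metis comp_apply funpow.simps(2) prefix_order.trans)
    then show "\<exists>N. \<forall>n\<ge>N. prefix (stake k F_omega) (morphism F_letter (stake n F_omega))"
      by blast
  qed
  then show ?thesis unfolding morphism_stream_def by (rule word_limitI)
qed

end

theory Submission
  imports Defs
begin

text \<open>Write $x$ for the fixed point of $F$. Since $x = F(x)$, the word is also $H(x)$ with
  $H = G \circ F$, which, unlike $G$, erases no letter. Both $F$ and $H$ are synchronizing, so a
  conjugacy class contained in the word is, up to short exceptions, the class of some $H(v)$, where
  $v$ loses at most its last letter in not being a factor of $x$, whatever conjugate is taken. This
  property passes from $F(v)$ to $v$, so $v$ is conjugate to some $F^n(c)$ with a letter $c$.

  Such $v$ are excluded by non-factors $l b r$ of $x$ that are attached to $v$ and can be followed
  along $F$: since $c c$ is not a factor of $x$, synchronization produces from $l b r$ a non-factor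
  $l' b' r'$ attached to $F(v)$, where $b'$ is $F(b)$ extended by the letters that do not
  distinguish $l$ and $r$ from their competitors. The pairs $(l, r)$ run through
  the two cycles $(2,2), (3,3), (4,4)$ and $(0,0), (1,0), (2,1)$. Applying $H$ instead of $F$
  turns $l b r$ into a conjugate of $H(v)$ that is not a factor of the word.\<close>

section \<open>Factors and conjugates of finite words\<close>

text \<open>If \<open>y'\<close> is a shortest factor whose image still contains \<open>u\<close>,
  then \<open>u\<close> reaches into its first and last blocks. All inner blocks and at least two
  more letters fit into \<open>u\<close>, which bounds \<open>y'\<close>.\<close>

lemma sublist_morphism_cover:
  assumes "sublist u (morphism f y)" and k: "\<And>c. k \<le> length (f c)"
  obtains y' where "sublist y' y" "sublist u (morphism f y')"
    "length y' \<le> 2 \<or> k * (length y' - 2) + 2 \<le> length u"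
proof -
  define P where "P y' \<longleftrightarrow> sublist y' y \<and> sublist u (morphism f y')" for y'
  have "P y" using assms by (simp add: P_def)
  then obtain y' where y': "P y'" and least: "\<And>z. P z \<Longrightarrow> length y' \<le> length z"
    using ex_has_least_nat[of P y length] by blast
  show thesis
  proof (cases "length y' \<le> 2")
    case True
    then show ?thesis using y' that unfolding P_def by blast
  next
    case False
    then obtain a r where "y' = a # r" "r \<noteq> []" by (cases y'; cases "tl y'") auto
    then obtain m b where e: "y' = a # m @ [b]" by (metis rev_exhaust)
    obtain p s where ps: "f a @ morphism f m @ f b = p @ u @ s"
      using y' e by (auto simp: P_def sublist_def)
    have "length p < length (f a)"
    proof (rule ccontr)
      assume "\<not> ?thesis"
      then obtain p' where "p = f a @ p'"
        using ps by (metis append_eq_append_conv_if append_take_drop_id le_neq_implies_less linorder_not_less)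
      then have "sublist u (morphism f (m @ [b]))" using ps by auto
      moreover have "sublist (m @ [b]) y"
        using y' e unfolding P_def by (metis append_Cons append_Nil sublist_append_leftI sublist_order.order.trans)
      ultimately show False using least[of "m @ [b]"] e by (simp add: P_def)
    qed
    moreover have "length s < length (f b)"
    proof (rule ccontr)
      assume "\<not> ?thesis"
      then have "length (p @ u) \<le> length (f a @ morphism f m)"
        using arg_cong[OF ps, of length] by simp
      then obtain s' where "f a @ morphism f m = p @ u @ s'"
        using ps by (metis append_assoc append_eq_append_conv_if append_take_drop_id)
      then have "sublist u (morphism f (a # m))" by auto
      moreover have "sublist (a # m) y"
        using y' e unfolding P_def
        by (metis append_Cons sublist_append_rightI sublist_order.order.trans)
      ultimately show False using least[of "a # m"] e by (simp add: P_def)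
    qed
    moreover have "k * length m \<le> length (morphism f m)"
      by (induction m) (auto simp: k add_mono)
    ultimately have "k * (length y' - 2) + 2 \<le> length u"
      using arg_cong[OF ps, of length] e by simp
    then show ?thesis using y' that unfolding P_def by blast
  qed
qed

lemma sublist_extend:
  assumes "sublist y w" "length y \<le> k" "k \<le> length w"
  obtains i where "i + k \<le> length w" "sublist y (take k (drop i w))"
proof -
  obtain p s where w: "w = p @ y @ s" using assms by (auto simp: sublist_def)
  show thesis
  proof (cases "length p + k \<le> length w")
    case True
    have "take k (drop (length p) w) = y @ take (k - length y) s"
      using w assms by simp
    then show ?thesis using True that by (metis sublist_append_rightI)
  next
    case False
    \<comment> \<open>A window starting at \<open>y\<close> would overrun \<open>w\<close>, so the
      last window is taken; it begins no later than \<open>y\<close>.\<close>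
    define i where "i = length w - k"
    have i: "i \<le> length p" "i + k = length w" using False assms by (auto simp: i_def)
    then have "take k (drop i w) = drop i p @ y @ s"
      using w by simp
    then show ?thesis using i that by (metis order_refl sublist_appendI)
  qed
qed

definition windows :: "nat \<Rightarrow> 'a list \<Rightarrow> 'a list list" where
  "windows k w = map (\<lambda>i. take k (drop i w)) [0..<Suc (length w) - k]"

lemma sublist_windowsE:
  assumes "sublist y w" "length y \<le> k" "k \<le> length w"
  obtains v where "v \<in> set (windows k w)" "sublist y v"
proof -
  obtain i where "i + k \<le> length w" "sublist y (take k (drop i w))"
    using sublist_extend[OF assms] .
  then show thesis by (intro that[of "take k (drop i w)"]) (auto simp: windows_def)
qed

lemma conjugate_rotate: "conjugate u v \<longleftrightarrow> (\<exists>n. v = rotate n u)"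
proof
  assume "conjugate u v"
  then obtain x y where "u = x @ y" "v = y @ x" by (auto simp: conjugate_def)
  then show "\<exists>n. v = rotate n u" by (metis rotate_append)
next
  assume "\<exists>n. v = rotate n u"
  then show "conjugate u v"
    by (metis append_take_drop_id conjugate_def rotate_drop_take)
qed

lemma conjugate_refl [simp]: "conjugate u u"
  unfolding conjugate_rotate by (metis rotate0 id_apply)

lemma conjugate_trans [trans]: "conjugate u v \<Longrightarrow> conjugate v w \<Longrightarrow> conjugate u w"
  unfolding conjugate_rotate by (auto simp: rotate_rotate)

lemma conjugate_append: "conjugate (x @ y) (y @ x)"
  by (auto simp: conjugate_def)

lemma conjugate_length: "conjugate u v \<Longrightarrow> length v = length u"
  by (auto simp: conjugate_def)

lemma conjugate_morphism: "conjugate u v \<Longrightarrow> conjugate (morphism f u) (morphism f v)"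
  unfolding conjugate_def by (metis morphism_simps(3))

section \<open>Factors of the two infinite words\<close>

abbreviation F :: "digit list \<Rightarrow> digit list" where
  "F \<equiv> morphism F_letter"

definition H_letter :: "digit \<Rightarrow> letter list" where
  "H_letter d = morphism G_letter (F_letter d)"

abbreviation H :: "digit list \<Rightarrow> letter list" where
  "H \<equiv> morphism H_letter"

lemma H_letter_simps [simp]:
  "H_letter D0 = [La, Lb, Lc, Ld]"
  "H_letter D1 = [Le, La, Lc, Ld]"
  "H_letter D2 = [La, Lb, Lc, Ld, Lb, Le, Lc, Ld]"
  "H_letter D3 = [Le, La, Lc, Ld, Lb, Le]"
  "H_letter D4 = [Le, La, Lc, Ld, Lb, Le, Lc, Ld]"
  by (simp_all add: H_letter_def)

lemma H_eq: "H y = morphism G_letter (F y)"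
  by (induction y) (simp_all add: H_letter_def)

definition factor_x :: "digit list \<Rightarrow> bool" where
  "factor_x y \<longleftrightarrow> (\<exists>n. sublist y ((F ^^ n) [D0]))"

text \<open>Since \<open>H\<close> erases no letter, a short factor of the image comes from few
  letters of \<open>x\<close>; with \<open>G\<close> a block could vanish.\<close>

definition factor_w :: "letter list \<Rightarrow> bool" where
  "factor_w u \<longleftrightarrow> (\<exists>y. factor_x y \<and> sublist u (H y))"

lemma factor_x_sublist: "factor_x y \<Longrightarrow> sublist y' y \<Longrightarrow> factor_x y'"
  unfolding factor_x_def by (meson sublist_order.order.trans)

lemma factor_w_sublist: "factor_w u \<Longrightarrow> sublist u' u \<Longrightarrow> factor_w u'"
  unfolding factor_w_def by (meson sublist_order.order.trans)

lemma factor_x_Nil [simp]: "factor_x []"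
  by (simp add: factor_x_def)

text \<open>Each iterate is a prefix of the next one, so a factor of an iterate also occurs in the
  image of that iterate.\<close>

lemma factor_xE:
  assumes "factor_x y"
  obtains z where "factor_x z" "sublist y (F z)"
proof -
  obtain n where n: "sublist y ((F ^^ n) [D0])" using assms by (auto simp: factor_x_def)
  then have "sublist y ((F ^^ Suc n) [D0])"
    unfolding F_pow_Suc by (meson sublist_append_rightI sublist_order.order.trans)
  then show thesis using that[of "(F ^^ n) [D0]"] by (auto simp: factor_x_def)
qed

text \<open>The \<open>k\<close> extra letters later exhibit short factors as prefixes of factors of
  length ten.\<close>

lemma factor_w5_extend:
  assumes "factor u w5"
  obtains t where "length t = k" "factor_w (u @ t)"
proof -
  obtain p s where w5: "w5 = p @- u @- s" using assms by (auto simp: factor_def)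
  let ?k = "length p + length u + k"
  have eq: "stake ?k w5 = p @ u @ stake k s"
    unfolding w5 by (simp add: stake_shift)
  obtain N where N: "prefix (p @ u @ stake k s) (morphism G_letter (stake N F_omega))"
    using w5_converges unfolding word_converges_def eq[symmetric] by blast
  obtain M where "\<forall>n\<ge>M. prefix (stake N F_omega) ((F ^^ n) [D0])"
    using F_omega_converges unfolding word_converges_def by blast
  \<comment> \<open>With exponent \<open>Suc M\<close>, one application of \<open>F\<close> can be
    split off and merged with \<open>G\<close> into \<open>H\<close>.\<close>
  then have "prefix (stake N F_omega) ((F ^^ Suc M) [D0])"
    using le_SucI[OF order_refl] by blast
  then have "prefix (p @ u @ stake k s) (morphism G_letter ((F ^^ Suc M) [D0]))"
    using N morphism_prefix prefix_order.trans by blast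
  then have "sublist (u @ stake k s) (H ((F ^^ M) [D0]))"
    by (auto simp: prefix_def sublist_def H_eq)
  moreover have "factor_x ((F ^^ M) [D0])" by (auto simp: factor_x_def)
  ultimately show thesis
    using that[of "stake k s"] by (auto simp: factor_w_def)
qed

lemma factor_w5: "factor u w5 \<Longrightarrow> factor_w u"
  by (metis factor_w5_extend factor_w_sublist sublist_append_rightI)

section \<open>Short factors\<close>

definition factors5 :: "digit list list" where
 "factors5 = [[D0,D1,D2,D0,D3],[D0,D1,D2,D4,D0],[D0,D3,D0,D1,D2],[D0,D3,D2,D3,D0],[D0,D3,D2,D4,D0],
   [D1,D2,D0,D3,D0],[D1,D2,D0,D3,D2],[D1,D2,D4,D0,D1],[D1,D2,D4,D0,D3],[D2,D0,D3,D0,D1],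
   [D2,D0,D3,D2,D3],[D2,D3,D0,D1,D2],[D2,D4,D0,D1,D2],[D2,D4,D0,D3,D2],[D3,D0,D1,D2,D0],
   [D3,D0,D1,D2,D4],[D3,D2,D3,D0,D1],[D3,D2,D4,D0,D1],[D4,D0,D1,D2,D0],[D4,D0,D3,D2,D3],
   [D4,D0,D3,D2,D4]]"

lemma windows_F_factors5:
  "\<forall>W\<in>set factors5. \<forall>y\<in>set (windows 5 (F W)). y \<in> set factors5"
  by code_simp

lemma length_F: "length y \<le> length (F y)"
proof (induction y)
  case (Cons c y)
  then show ?case by (cases c) auto
qed simp

lemma length_factors5: "W \<in> set factors5 \<Longrightarrow> length W = 5"
  by (auto simp: factors5_def)

text \<open>Induction on the number of iterations: at most five letters of an image are covered by
  the images of at most five letters, and the length-5 windows of images of listed words are listed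
  again.\<close>

lemma factor_x_factors5:
  assumes "factor_x y" "length y \<le> 5"
  shows "\<exists>W\<in>set factors5. sublist y W"
proof -
  obtain n where "sublist y ((F ^^ n) [D0])" using assms by (auto simp: factor_x_def)
  then show ?thesis using assms(2)
  proof (induction n arbitrary: y)
    case 0
    then have "sublist y [D0]" by simp
    then have "sublist y ([D0] @ [D1,D2,D0,D3])"
      by (meson sublist_append_rightI sublist_order.order.trans)
    then show ?case by (simp add: factors5_def)
  next
    case (Suc n)
    then have "sublist y (F ((F ^^ n) [D0]))" by simp
    then obtain y' where y': "sublist y' ((F ^^ n) [D0])" "sublist y (F y')"
      "length y' \<le> 2 \<or> 1 * (length y' - 2) + 2 \<le> length y"
      by (rule sublist_morphism_cover[where k = 1]) (auto elim: F_letter.elims simp: Suc_le_eq)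
    then have "length y' \<le> 5" using Suc.prems by auto
    then obtain W where W: "W \<in> set factors5" "sublist y' W" using Suc.IH y' by blast
    have "sublist y (F W)"
      using W(2) y'(2) by (auto simp: sublist_def) (metis append.assoc)
    then obtain v where v: "v \<in> set (windows 5 (F W))" "sublist y v"
      using sublist_windowsE Suc.prems(2) length_F[of W] length_factors5[OF W(1)] by metis
    then show ?case using windows_F_factors5 W(1) by blast
  qed
qed

text \<open>Blocks of \<open>H\<close> have at least four letters, so needing six of them forces
  length at least 4 * 4 + 2 = 18; hence the bound 17.\<close>

lemma factor_w_factors5:
  assumes "factor_w u" "length u \<le> 17"
  shows "\<exists>W\<in>set factors5. sublist u (H W)"
proof -
  obtain y where y: "factor_x y" "sublist u (H y)" using assms by (auto simp: factor_w_def)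
  obtain y' where y': "sublist y' y" "sublist u (H y')"
      "length y' \<le> 2 \<or> 4 * (length y' - 2) + 2 \<le> length u"
  proof (rule sublist_morphism_cover[OF y(2), where k = 4])
    show "4 \<le> length (H_letter c)" for c by (cases c) auto
  qed
  then have "length y' \<le> 5" using assms by auto
  then obtain W where "W \<in> set factors5" "sublist y' W"
    using factor_x_factors5 factor_x_sublist y y' by metis
  moreover have "sublist u (H W)"
      using calculation(2) y'(2) by (auto simp: sublist_def) (metis append.assoc)
  ultimately show ?thesis by blast
qed

section \<open>Synchronization\<close>

text \<open>In the images of \<open>F\<close>, 0 and 2 occur only as first letters, and every image
  begins with one of them: they mark the block boundaries.\<close>

definition starts_F :: "digit list \<Rightarrow> bool" where
  "starts_F t \<longleftrightarrow> (\<exists>s. t = D0 # s \<or> t = D2 # s)"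

lemma starts_F_simps [simp]:
  "\<not> starts_F []" "starts_F (c # s) \<longleftrightarrow> c = D0 \<or> c = D2"
  by (auto simp: starts_F_def)

lemma starts_F_append: "starts_F t \<Longrightarrow> starts_F (t @ s)"
  by (auto simp: starts_F_def)

lemma starts_F_F: "y \<noteq> [] \<Longrightarrow> starts_F (F y)"
  by (cases y rule: list.exhaust; cases "hd y") auto

lemma F_sync:
  assumes "F z = p @ t" "starts_F t"
  obtains z1 z2 where "z = z1 @ z2" "F z1 = p" "F z2 = t"
  using assms
proof (induction z arbitrary: p thesis)
  case (Cons c z)
  consider us where "p = F_letter c @ us" "F z = us @ t"
    | us where "F_letter c = p @ us" "t = us @ F z"
    using Cons.prems(2) by (auto simp: append_eq_append_conv2)
  then show ?case
  proof cases
    case 1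
    obtain z1 z2 where "z = z1 @ z2" "F z1 = us" "F z2 = t"
      using Cons.IH[OF _ 1(2) Cons.prems(3)] .
    then show ?thesis using Cons.prems(1)[of "c # z1" z2] 1 by simp
  next
    case 2
    \<comment> \<open>A cut strictly inside a block would put 1, 3 or 4 in front of
      \<open>t\<close>.\<close>
    have "p = [] \<or> us = []"
      using 2 Cons.prems(3) by (cases c) (auto simp: Cons_eq_append_conv)
    then show ?thesis using Cons.prems(1)[of "[]" "c # z"] Cons.prems(1)[of "[c]" z] 2 by auto
  qed
qed simp

text \<open>Only \<open>F(1) = 2\<close> is a proper prefix of other blocks, 24 and 23, and no
  following block can supply the missing 4 or 3.\<close>

lemma F_inj: "F y = F z \<Longrightarrow> y = z"
proof (induction y arbitrary: z)
  case Nil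
  then show ?case by (cases z; cases "hd z") auto
next
  case (Cons c y)
  then obtain d z' where z: "z = d # z'" by (cases z; cases c) auto
  have "\<forall>s. F y \<noteq> D3 # s \<and> F y \<noteq> D4 # s" "\<forall>s. F z' \<noteq> D3 # s \<and> F z' \<noteq> D4 # s"
    using starts_F_F[of y] starts_F_F[of z'] by (cases y; cases z'; force)+
  then have "c = d" using Cons.prems z by (cases c; cases d) (auto simp: eq_commute)
  then show ?case using Cons z by simp
qed

text \<open>The images under \<open>H\<close> can begin in the middle of one another. A left context ending in
  \<open>d\<close>, or two or three letters of lookahead, decide whether a position is a block boundary.\<close>

definition starts_H :: "letter list \<Rightarrow> letter list \<Rightarrow> bool" where
  "starts_H p t \<longleftrightarrow> (\<exists>s. t = La # Lb # s \<or> t = Le # La # Lc # s)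
     \<or> (\<exists>q s. p = q @ [Ld] \<and> (t = La # s \<or> t = Le # s))"

lemma starts_H_mono: "starts_H p t \<Longrightarrow> starts_H (x @ p) (t @ s)"
  by (auto simp: starts_H_def)

lemma H_hd: "y \<noteq> [] \<Longrightarrow> \<exists>s. H y = La # Lb # s \<or> H y = Le # La # Lc # s"
  by (cases y rule: list.exhaust; cases "hd y") auto

lemma H_sync:
  assumes "H z = p @ t" "starts_H p t"
  obtains z1 z2 where "z = z1 @ z2" "H z1 = p" "H z2 = t"
  using assms
proof (induction z arbitrary: p thesis)
  case Nil
  then show ?case by (auto simp: starts_H_def)
next
  case (Cons c z)
  consider us where "p = H_letter c @ us" "H z = us @ t"
    | us where "H_letter c = p @ us" "t = us @ H z"
    using Cons.prems(2) by (auto simp: append_eq_append_conv2)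
  then show ?case
  proof cases
    case 1
    show ?thesis
    proof (cases "us = []")
      case True
      then show ?thesis using Cons.prems(1)[of "[c]" z] 1 by simp
    next
      case False
      \<comment> \<open>A nonempty \<open>us\<close> keeps the last letter of the left context, so a
        boundary signalled by \<open>Ld\<close> remains signalled.\<close>
      then have "starts_H us t"
        using Cons.prems(3) 1(1) by (cases us rule: rev_cases) (auto simp: starts_H_def)
      then obtain z1 z2 where "z = z1 @ z2" "H z1 = us" "H z2 = t"
        using Cons.IH[OF _ 1(2)] by blast
      then show ?thesis using Cons.prems(1)[of "c # z1" z2] 1 by simp
    qed
  next
    case 2
    have "z = [] \<or> (\<exists>s. H z = La # Lb # s \<or> H z = Le # La # Lc # s)" using H_hd by blast
    \<comment> \<open>The lookahead may cross into \<open>H z\<close>: the final e of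
      \<open>H(3)\<close> is followed by ab or eac, so eac is never read from there.\<close>
    then have "p = [] \<or> us = []"
      using 2 Cons.prems(3) by (cases c) (auto simp: starts_H_def Cons_eq_append_conv)
    then show ?thesis using Cons.prems(1)[of "[]" "c # z"] Cons.prems(1)[of "[c]" z] 2 by auto
  qed
qed

text \<open>Where one block is a proper prefix of another, the missing rest begins with b or c, but
  images begin with a or e.\<close>

lemma H_inj: "H y = H z \<Longrightarrow> y = z"
proof (induction y arbitrary: z)
  case Nil
  then show ?case by (cases z; cases "hd z") auto
next
  case (Cons c y)
  then obtain d z' where z: "z = d # z'" by (cases z; cases c) auto
  have "\<forall>s. H y \<noteq> Lb # s \<and> H y \<noteq> Lc # s" "\<forall>s. H z' \<noteq> Lb # s \<and> H z' \<noteq> Lc # s"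
    using H_hd[of y] H_hd[of z'] by (cases y; cases z'; force)+
  then have "c = d" using Cons.prems z by (cases c; cases d) (auto simp: eq_commute)
  then show ?case using Cons z by simp
qed

lemma factor_x_F_decode:
  assumes "factor_x (q @ F b @ r)" "starts_F r"
  obtains z1 z2 where "factor_x (z1 @ b @ z2)" "suffix q (F z1)" "prefix r (F z2)"
proof -
  obtain z where "factor_x z" "sublist (q @ F b @ r) (F z)"
    using factor_xE[OF assms(1)] .
  then obtain p s where z: "factor_x z" "F z = (p @ q) @ F b @ r @ s"
    by (auto simp: sublist_def)
  have r: "starts_F (F b @ r @ s)" "starts_F (r @ s)"
    using assms(2) by (cases "b = []"; auto simp: starts_F_append starts_F_F)+
  obtain z1 z' where 1: "z = z1 @ z'" "F z1 = p @ q" "F z' = F b @ r @ s"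
    using F_sync[OF z(2) r(1)] .
  obtain b' z2 where 2: "z' = b' @ z2" "F b' = F b" "F z2 = r @ s"
    using F_sync[OF 1(3) r(2)] .
  have "b' = b" using F_inj 2(2) by blast
  then show thesis using that[of z1 z2] z(1) 1 2 by (auto simp: suffix_def)
qed

lemma factor_w_H_decode:
  assumes "factor_w (q @ H b @ r)" "starts_H q (H b @ r)" "starts_H (q @ H b) r"
  obtains z1 z2 where "factor_x (z1 @ b @ z2)" "suffix q (H z1)" "prefix r (H z2)"
proof -
  obtain z p s where z: "factor_x z" "H z = (p @ q) @ H b @ r @ s"
    using assms(1) by (auto simp: factor_w_def sublist_def)
  have "starts_H (p @ q) (H b @ r @ s)" "starts_H ((p @ q) @ H b) (r @ s)"
    using starts_H_mono[OF assms(2), of p s] starts_H_mono[OF assms(3), of p s] by simp_all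
  note r = this
  obtain z1 z' where 1: "z = z1 @ z'" "H z1 = p @ q" "H z' = H b @ r @ s"
    using H_sync[OF z(2) r(1)] .
  \<comment> \<open>The second cut is made in all of \<open>H z\<close>, because for empty
    \<open>b\<close> the signalling \<open>Ld\<close> may lie in \<open>q\<close>.\<close>
  have "H z = ((p @ q) @ H b) @ (r @ s)" using z(2) by simp
  then obtain y z2 where 2: "z = y @ z2" "H y = (p @ q) @ H b" "H z2 = r @ s"
    using H_sync[OF _ r(2)] by blast
  have "H y = H z1 @ H b" using 1 2 by simp
  then have "H (z1 @ b) = H y" by simp
  then have "y = z1 @ b" using H_inj by metis
  then show thesis using that[of z1 z2] z(1) 1 2 by (auto simp: suffix_def)
qed

section \<open>Obstructions\<close>

definition non_factors :: "digit list list" where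
  "non_factors = [[D0,D0],[D0,D2],[D0,D4],[D1,D0],[D1,D1],[D1,D3],[D1,D4],[D2,D1],[D2,D2],
     [D3,D1],[D3,D3],[D3,D4],[D4,D1],[D4,D2],[D4,D3],[D4,D4],[D1,D2,D3],[D2,D3,D2],[D3,D0,D3],
     [D0,D1,D2,D1],[D0,D1,D2,D3],[D4,D0,D3,D0]]"

lemma not_factor_x:
  assumes "y \<in> set non_factors"
  shows "\<not> factor_x (p @ y @ s)"
proof -
  have "\<forall>y\<in>set non_factors. length y \<le> 5 \<and> (\<forall>W\<in>set factors5. \<not> sublist y W)"
    by code_simp
  then show ?thesis
    using assms by (metis factor_x_factors5 factor_x_sublist sublist_appendI)
qed

text \<open>Reduces excluding \<open>q @ F b @ r\<close> to a case check of the two neighbours of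
  \<open>b\<close>. Reversal turns the suffix condition on the left into a prefix condition.\<close>

lemma factor_x_F_decode_letters:
  assumes "factor_x (q @ F b @ r)" "starts_F r" "q \<noteq> []"
  obtains l c y y' where "factor_x (l # b @ [c])"
    "prefix (rev q) (rev (F_letter l) @ y)" "prefix r (F_letter c @ y')" "y' = [] \<or> starts_F y'"
proof -
  obtain z1 z2 where z: "factor_x (z1 @ b @ z2)" "suffix q (F z1)" "prefix r (F z2)"
    using factor_x_F_decode[OF assms(1,2)] .
  have "z1 \<noteq> []" "z2 \<noteq> []" using z assms by auto
  then obtain y l c y' where zz: "z1 = y @ [l]" "z2 = c # y'" by (metis list.exhaust rev_exhaust)
  have "sublist (l # b @ [c]) (z1 @ b @ z2)"
    unfolding zz sublist_def by (metis append.assoc append_Cons append_Nil)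
  then have "factor_x (l # b @ [c])" using z(1) factor_x_sublist by blast
  moreover have "F y' = [] \<or> starts_F (F y')" by (cases "y' = []") (simp_all add: starts_F_F)
  ultimately show thesis
    using z(2,3) zz
    by (intro that[of l c "rev (F y)" "F y'"]) (auto simp: suffix_to_prefix)
qed

lemma factor_w_H_decode_letters:
  assumes "factor_w (q @ H b @ r)" "starts_H q (H b @ r)" "starts_H (q @ H b) r" "q \<noteq> []"
  obtains l c y y' where "factor_x (l # b @ [c])"
    "prefix (rev q) (rev (H_letter l) @ y)" "prefix r (H_letter c @ y')"
    "y' = [] \<or> hd y' = La \<or> hd y' = Le"
proof -
  obtain z1 z2 where z: "factor_x (z1 @ b @ z2)" "suffix q (H z1)" "prefix r (H z2)"
    using factor_w_H_decode[OF assms(1,2,3)] .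
  have "z1 \<noteq> []" "z2 \<noteq> []" using z assms by (auto simp: starts_H_def)
  then obtain y l c y' where zz: "z1 = y @ [l]" "z2 = c # y'" by (metis list.exhaust rev_exhaust)
  have "sublist (l # b @ [c]) (z1 @ b @ z2)"
    unfolding zz sublist_def by (metis append.assoc append_Cons append_Nil)
  then have "factor_x (l # b @ [c])" using z(1) factor_x_sublist by blast
  moreover have "H y' = [] \<or> hd (H y') = La \<or> hd (H y') = Le"
    using H_hd[of y'] by (cases "y' = []") auto
  ultimately show thesis
    using z(2,3) zz
    by (intro that[of l c "rev (H y)" "H y'"]) (auto simp: suffix_to_prefix)
qed

text \<open>The conditions on \<open>b\<close> are what makes \<open>l\<close> and \<open>r\<close> the only possible neighbours of \<open>b\<close>
  with the suffix and prefix that the next non-factor retains. In the first four cases \<open>l = r\<close>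
  is a single letter of the circular word \<open>v\<close>; in the last two \<open>l\<close> and \<open>r\<close> are different letters,
  so that \<open>l b r\<close> is itself conjugate to \<open>v\<close>.\<close>

inductive obstructed :: "digit list \<Rightarrow> bool" where
  O22: "\<not> factor_x (D2 # b @ [D2]) \<Longrightarrow> b = [] \<or> (\<exists>s. b = D3 # s) \<Longrightarrow>
      conjugate v (D2 # b) \<Longrightarrow> obstructed v"
| O33: "\<not> factor_x (D3 # b @ [D3]) \<Longrightarrow> b = [] \<or> (\<exists>s. b = s @ [D0]) \<Longrightarrow>
      conjugate v (D3 # b) \<Longrightarrow> obstructed v"
| O44: "\<not> factor_x (D4 # b @ [D4]) \<Longrightarrow> b = [] \<or> b = [D2] \<or> (\<exists>s. b = s @ [D0, D1, D2]) \<Longrightarrow>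
      conjugate v (D4 # b) \<Longrightarrow> obstructed v"
| O00: "\<not> factor_x (D0 # b @ [D0]) \<Longrightarrow> b = [] \<or> (\<exists>s. b = s @ [D2]) \<Longrightarrow>
      conjugate v (D0 # b) \<Longrightarrow> obstructed v"
| O10: "\<not> factor_x (D1 # b @ [D0]) \<Longrightarrow> conjugate v (D0 # D1 # b) \<Longrightarrow> obstructed v"
| O21: "\<not> factor_x (D2 # b @ [D1]) \<Longrightarrow> conjugate v (D1 # D2 # b) \<Longrightarrow> obstructed v"

lemma obstructed_conjugate: "conjugate v v' \<Longrightarrow> obstructed v' \<Longrightarrow> obstructed v"
  by (erule obstructed.cases) (metis obstructed.intros conjugate_trans)+

text \<open>The starting point of both cycles, with \<open>b = []\<close>: no letter is repeated in
  \<open>x\<close>.\<close>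

lemma obstructed_letter: "c \<noteq> D1 \<Longrightarrow> obstructed [c]"
proof -
  have "\<not> factor_x [c, c]" for c
    using not_factor_x[of "[c, c]" "[]" "[]"] by (cases c) (simp_all add: non_factors_def)
  then show "c \<noteq> D1 \<Longrightarrow> obstructed [c]"
    by (cases c) (metis append_Nil conjugate_refl obstructed.intros)+
qed

lemma conjugate_rotateI: "conjugate v (x @ y) \<Longrightarrow> conjugate v (y @ x)"
  using conjugate_append conjugate_trans by blast

text \<open>A suffix of the image of \<open>l\<close> is placed before \<open>F b\<close> and a
  prefix of the image of \<open>r\<close> after it. They are chosen so that only \<open>l\<close>
  and \<open>r\<close> can surround \<open>b\<close>, and the conditions on \<open>b\<close> remove
  the remaining ambiguity.\<close>

lemma obstructed_F:
  assumes "obstructed v"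
  shows "obstructed (F v)"
  using assms
proof cases
  case (O22 b)
  have "\<not> factor_x (D3 # (F b @ [D0]) @ [D3])"
  proof
    assume "factor_x (D3 # (F b @ [D0]) @ [D3])"
    then have "factor_x ([D3] @ F b @ [D0, D3])" by simp
    then obtain l c y y' where d: "factor_x (l # b @ [c])"
      "prefix [D3] (rev (F_letter l) @ y)" "prefix [D0, D3] (F_letter c @ y')"
      by (rule factor_x_F_decode_letters) auto
    \<comment> \<open>The letter 3 also ends \<open>F(4)\<close>; the condition on \<open>b\<close>
      excludes 4 since 42 and 43 do not occur in \<open>x\<close>.\<close>
    have "l = D2 \<or> l = D4" "c = D2" using d(2,3) by (cases l; cases c; simp)+
    moreover have "l \<noteq> D4"
      using O22(2) d(1) \<open>c = D2\<close> not_factor_x[of "[D4, D3]" "[]"] not_factor_x[of "[D4, D2]" "[]" "[]"]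
      by (auto simp: non_factors_def)
    ultimately show False using O22(1) d(1) by simp
  qed
  moreover have "conjugate (F v) (D3 # F b @ [D0])"
    using conjugate_morphism[OF O22(3), of F_letter] conjugate_rotateI[of "F v" "[D0]" "D3 # F b"] by simp
  ultimately show ?thesis by (intro O33[of "F b @ [D0]"]) auto
next
  case (O33 b)
  have "\<not> factor_x (D4 # (F b @ [D2]) @ [D4])"
  proof
    assume "factor_x (D4 # (F b @ [D2]) @ [D4])"
    then have "factor_x ([D4] @ F b @ [D2, D4])" by simp
    then obtain l c y y' where d: "factor_x (l # b @ [c])"
      "prefix [D4] (rev (F_letter l) @ y)" "prefix [D2, D4] (F_letter c @ y')" "y' = [] \<or> starts_F y'"
      by (rule factor_x_F_decode_letters) auto
    \<comment> \<open>Reading 24 as \<open>F(1) = 2\<close> followed by 4 is impossible, as no image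
      begins with 4.\<close>
    have "l = D3" "c = D3" using d(2,3,4) by (cases l; cases c; auto simp: prefix_def)+
    then show False using O33(1) d(1) by simp
  qed
  moreover have "conjugate (F v) (D4 # F b @ [D2])"
    using conjugate_morphism[OF O33(3), of F_letter] conjugate_rotateI[of "F v" "[D2]" "D4 # F b"] by simp
  ultimately show ?thesis using O33(2) by (intro O44[of "F b @ [D2]"]) auto
next
  case (O44 b)
  have "\<not> factor_x (D2 # (D3 # F b) @ [D2])"
  proof
    assume "factor_x (D2 # (D3 # F b) @ [D2])"
    then have "factor_x ([D2, D3] @ F b @ [D2])" by simp
    then obtain l c y y' where d: "factor_x (l # b @ [c])"
      "prefix [D3, D2] (rev (F_letter l) @ y)" "prefix [D2] (F_letter c @ y')"
      by (rule factor_x_F_decode_letters) auto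
    have l: "l = D4" using d(2) by (cases l) auto
    have c: "c = D1 \<or> c = D3 \<or> c = D4" using d(3) by (cases c) auto
    \<comment> \<open>Images of 1, 3 and 4 all begin with 2. The end of \<open>l b\<close> decides:
      41, 43, 0121 and 0123 do not occur, and for \<open>b = [D2]\<close> already 42 is
      impossible.\<close>
    from O44(2) have "c = D4"
    proof (elim disjE exE)
      assume "b = []"
      then show ?thesis using c l d(1) not_factor_x[of "[l, c]" "[]" "[]"]
        by (auto simp: non_factors_def)
    next
      assume "b = [D2]"
      then show ?thesis using l d(1) not_factor_x[of "[D4, D2]" "[]" "[c]"]
        by (auto simp: non_factors_def)
    next
      fix s assume "b = s @ [D0, D1, D2]"
      then show ?thesis using c d(1) not_factor_x[of "[D0, D1, D2, c]" "l # s" "[]"]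
        by (auto simp: non_factors_def)
    qed
    then show False using O44(1) l d(1) by simp
  qed
  moreover have "conjugate (F v) (D2 # D3 # F b)"
    using conjugate_morphism[OF O44(3), of F_letter] by simp
  ultimately show ?thesis by (intro O22[of "D3 # F b"]) auto
next
  case (O00 b)
  have "\<not> factor_x (D1 # F b @ [D0])"
  proof
    assume "factor_x (D1 # F b @ [D0])"
    then have "factor_x ([D1] @ F b @ [D0])" by simp
    then obtain l c y y' where d: "factor_x (l # b @ [c])"
      "prefix [D1] (rev (F_letter l) @ y)" "prefix [D0] (F_letter c @ y')"
      by (rule factor_x_F_decode_letters) auto
    have l: "l = D0" and c: "c = D0 \<or> c = D2" using d(2,3) by (cases l; cases c; simp)+
    have "c \<noteq> D2"
      using O00(2) d(1) l not_factor_x[of "[D0, D2]" "[]" "[]"] not_factor_x[of "[D2, D2]" _ "[]"]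
      by (auto simp: non_factors_def) (metis append_Cons)
    then show False using O00(1) l c d(1) by simp
  qed
  moreover have "conjugate (F v) (D0 # D1 # F b)"
    using conjugate_morphism[OF O00(3), of F_letter] by simp
  ultimately show ?thesis by (rule O10)
next
  case (O10 b)
  have "\<not> factor_x (D2 # (F b @ [D0]) @ [D1])"
  proof
    assume "factor_x (D2 # (F b @ [D0]) @ [D1])"
    then have "factor_x ([D2] @ F b @ [D0, D1])" by simp
    then obtain l c y y' where d: "factor_x (l # b @ [c])"
      "prefix [D2] (rev (F_letter l) @ y)" "prefix [D0, D1] (F_letter c @ y')"
      by (rule factor_x_F_decode_letters) auto
    have "l = D1" "c = D0" using d(2,3) by (cases l; cases c; simp)+
    then show False using O10(1) d(1) by simp
  qed
  moreover have "conjugate (F v) (D1 # D2 # F b @ [D0])"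
    using conjugate_morphism[OF O10(2), of F_letter] conjugate_rotateI[of "F v" "[D0]" "D1 # D2 # F b"] by simp
  ultimately show ?thesis by (intro O21[of "F b @ [D0]"]) auto
next
  case (O21 b)
  have "\<not> factor_x (D0 # (D3 # F b @ [D2]) @ [D0])"
  proof
    assume "factor_x (D0 # (D3 # F b @ [D2]) @ [D0])"
    \<comment> \<open>The final 0 lies beyond the block of \<open>c\<close> and separates
      \<open>F(1) = 2\<close> from 24 and 23.\<close>
    then have "factor_x ([D0, D3] @ F b @ [D2, D0])" by simp
    then obtain l c y y' where d: "factor_x (l # b @ [c])"
      "prefix [D3, D0] (rev (F_letter l) @ y)" "prefix [D2, D0] (F_letter c @ y')"
      by (rule factor_x_F_decode_letters) auto
    have "l = D2" "c = D1" using d(2,3) by (cases l; cases c; simp)+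
    then show False using O21(1) d(1) by simp
  qed
  moreover have "conjugate (F v) (D0 # D3 # F b @ [D2])"
    using conjugate_morphism[OF O21(2), of F_letter] conjugate_rotateI[of "F v" "[D2]" "D0 # D3 # F b"] by simp
  ultimately show ?thesis by (intro O00[of "D3 # F b @ [D2]"]) auto
qed

text \<open>The letters around \<open>H b\<close> are cut from the blocks of the letters of
  \<open>v\<close> outside \<open>b\<close>, so the whole word is a conjugate of \<open>H v\<close>.
  They suffice, with the condition on \<open>b\<close>, to identify both neighbours of
  \<open>b\<close>.\<close>

lemma obstructed_H:
  assumes "obstructed v"
  obtains u where "conjugate (H v) u" "\<not> factor_w u"
  using assms
proof cases
  case (O22 b)
  have "\<not> factor_w ([Le, Lc, Ld] @ H b @ [La, Lb, Lc, Ld, Lb])"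
  proof
    assume "factor_w ([Le, Lc, Ld] @ H b @ [La, Lb, Lc, Ld, Lb])"
    then obtain l c y y' where d: "factor_x (l # b @ [c])"
      "prefix (rev [Le, Lc, Ld]) (rev (H_letter l) @ y)" "prefix [La, Lb, Lc, Ld, Lb] (H_letter c @ y')"
      "y' = [] \<or> hd y' = La \<or> hd y' = Le"
    proof (rule factor_w_H_decode_letters)
      show "starts_H [Le, Lc, Ld] (H b @ [La, Lb, Lc, Ld, Lb])"
        using H_hd[of b] by (cases "b = []") (auto simp: starts_H_def)
    qed (auto simp: starts_H_def)
    have "l = D2 \<or> l = D4" "c = D2" using d(2,3,4) by (cases l; cases c; auto simp: prefix_def)+
    moreover have "l \<noteq> D4"
      using O22(2) d(1) \<open>c = D2\<close> not_factor_x[of "[D4, D3]" "[]"] not_factor_x[of "[D4, D2]" "[]" "[]"]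
      by (auto simp: non_factors_def)
    ultimately show False using O22(1) d(1) by simp
  qed
  moreover have "conjugate (H v) ([Le, Lc, Ld] @ H b @ [La, Lb, Lc, Ld, Lb])"
    using conjugate_morphism[OF O22(3), of H_letter]
      conjugate_rotateI[of "H v" "[La, Lb, Lc, Ld, Lb]" "[Le, Lc, Ld] @ H b"] by simp
  ultimately show ?thesis using that by blast
next
  case (O33 b)
  have "\<not> factor_w ([Le] @ H b @ [Le, La, Lc, Ld, Lb])"
  proof
    assume "factor_w ([Le] @ H b @ [Le, La, Lc, Ld, Lb])"
    then obtain l c y y' where d: "factor_x (l # b @ [c])"
      "prefix (rev [Le]) (rev (H_letter l) @ y)" "prefix [Le, La, Lc, Ld, Lb] (H_letter c @ y')"
      "y' = [] \<or> hd y' = La \<or> hd y' = Le"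
    proof (rule factor_w_H_decode_letters)
      show "starts_H [Le] (H b @ [Le, La, Lc, Ld, Lb])"
        using H_hd[of b] by (cases "b = []") (auto simp: starts_H_def)
    qed (auto simp: starts_H_def)
    have "l = D3" "c = D3 \<or> c = D4" using d(2,3,4) by (cases l; cases c; auto simp: prefix_def)+
    moreover have "c \<noteq> D4"
      using O33(2) d(1) \<open>l = D3\<close> not_factor_x[of "[D3, D4]" "[]" "[]"] not_factor_x[of "[D0, D4]" _ "[]"]
      by (auto simp: non_factors_def) (metis append_Cons)
    ultimately show False using O33(1) d(1) by simp
  qed
  moreover have "conjugate (H v) ([Le] @ H b @ [Le, La, Lc, Ld, Lb])"
    using conjugate_morphism[OF O33(3), of H_letter]
      conjugate_rotateI[of "H v" "[Le, La, Lc, Ld, Lb]" "[Le] @ H b"] by simp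
  ultimately show ?thesis using that by blast
next
  case (O44 b)
  let ?q = "[La, Lc, Ld, Lb, Le, Lc, Ld]"
  have "\<not> factor_w (?q @ H b @ [Le])"
  proof
    assume "factor_w (?q @ H b @ [Le])"
    then obtain l c y y' where d: "factor_x (l # b @ [c])"
      "prefix (rev ?q) (rev (H_letter l) @ y)" "prefix [Le] (H_letter c @ y')"
    proof (rule factor_w_H_decode_letters)
      show "starts_H ?q (H b @ [Le])"
        using H_hd[of b] by (cases "b = []") (auto simp: starts_H_def)
      \<comment> \<open>One letter of lookahead does not fix the boundary; the condition on
        \<open>b\<close> makes the left context end in d.\<close>
      show "starts_H (?q @ H b) [Le]"
        using O44(2) by (auto simp: starts_H_def)
    qed auto
    have l: "l = D4" using d(2) by (cases l) auto
    have c: "c = D1 \<or> c = D3 \<or> c = D4" using d(3) by (cases c) auto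
    from O44(2) have "c = D4"
    proof (elim disjE exE)
      assume "b = []"
      then show ?thesis using c l d(1) not_factor_x[of "[l, c]" "[]" "[]"]
        by (auto simp: non_factors_def)
    next
      assume "b = [D2]"
      then show ?thesis using l d(1) not_factor_x[of "[D4, D2]" "[]" "[c]"]
        by (auto simp: non_factors_def)
    next
      fix s assume "b = s @ [D0, D1, D2]"
      then show ?thesis using c d(1) not_factor_x[of "[D0, D1, D2, c]" "l # s" "[]"]
        by (auto simp: non_factors_def)
    qed
    then show False using O44(1) l d(1) by simp
  qed
  moreover have "conjugate (H v) (?q @ H b @ [Le])"
    using conjugate_morphism[OF O44(3), of H_letter]
      conjugate_rotateI[of "H v" "[Le]" "?q @ H b"] by simp
  ultimately show ?thesis using that by blast
next
  case (O00 b)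
  have "\<not> factor_w ([Lb, Lc, Ld] @ H b @ [La])"
  proof
    assume "factor_w ([Lb, Lc, Ld] @ H b @ [La])"
    then obtain l c y y' where d: "factor_x (l # b @ [c])"
      "prefix (rev [Lb, Lc, Ld]) (rev (H_letter l) @ y)" "prefix [La] (H_letter c @ y')"
    proof (rule factor_w_H_decode_letters)
      show "starts_H [Lb, Lc, Ld] (H b @ [La])"
        using H_hd[of b] by (cases "b = []") (auto simp: starts_H_def)
      show "starts_H ([Lb, Lc, Ld] @ H b) [La]"
        using O00(2) by (auto simp: starts_H_def)
    qed auto
    have l: "l = D0" and c: "c = D0 \<or> c = D2" using d(2,3) by (cases l; cases c; simp)+
    have "c \<noteq> D2"
      using O00(2) d(1) l not_factor_x[of "[D0, D2]" "[]" "[]"] not_factor_x[of "[D2, D2]" _ "[]"]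
      by (auto simp: non_factors_def) (metis append_Cons)
    then show False using O00(1) l c d(1) by simp
  qed
  moreover have "conjugate (H v) ([Lb, Lc, Ld] @ H b @ [La])"
    using conjugate_morphism[OF O00(3), of H_letter]
      conjugate_rotateI[of "H v" "[La]" "[Lb, Lc, Ld] @ H b"] by simp
  ultimately show ?thesis using that by blast
next
  case (O10 b)
  have "\<not> factor_w ([La, Lc, Ld] @ H b @ [La, Lb, Lc, Ld, Le])"
  proof
    assume "factor_w ([La, Lc, Ld] @ H b @ [La, Lb, Lc, Ld, Le])"
    then obtain l c y y' where d: "factor_x (l # b @ [c])"
      "prefix (rev [La, Lc, Ld]) (rev (H_letter l) @ y)" "prefix [La, Lb, Lc, Ld, Le] (H_letter c @ y')"
    proof (rule factor_w_H_decode_letters)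
      show "starts_H [La, Lc, Ld] (H b @ [La, Lb, Lc, Ld, Le])"
        using H_hd[of b] by (cases "b = []") (auto simp: starts_H_def)
    qed (auto simp: starts_H_def)
    have "l = D1" "c = D0" using d(2,3) by (cases l; cases c; simp)+
    then show False using O10(1) d(1) by simp
  qed
  moreover have "conjugate (H v) ([La, Lc, Ld] @ H b @ [La, Lb, Lc, Ld, Le])"
    using conjugate_morphism[OF O10(2), of H_letter]
      conjugate_rotateI[of "H v" "[La, Lb, Lc, Ld, Le]" "[La, Lc, Ld] @ H b"] by simp
  ultimately show ?thesis using that by blast
next
  case (O21 b)
  let ?q = "[Lb, Lc, Ld, Lb, Le, Lc, Ld]"
  have "\<not> factor_w (?q @ H b @ [Le, La, Lc, Ld, La])"
  proof
    assume "factor_w (?q @ H b @ [Le, La, Lc, Ld, La])"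
    then obtain l c y y' where d: "factor_x (l # b @ [c])"
      "prefix (rev ?q) (rev (H_letter l) @ y)" "prefix [Le, La, Lc, Ld, La] (H_letter c @ y')"
    proof (rule factor_w_H_decode_letters)
      show "starts_H ?q (H b @ [Le, La, Lc, Ld, La])"
        using H_hd[of b] by (cases "b = []") (auto simp: starts_H_def)
    qed (auto simp: starts_H_def)
    have "l = D2" "c = D1" using d(2,3) by (cases l; cases c; simp)+
    then show False using O21(1) d(1) by simp
  qed
  moreover have "conjugate (H v) (?q @ H b @ [Le, La, Lc, Ld, La])"
    using conjugate_morphism[OF O21(2), of H_letter]
      conjugate_rotateI[of "H v" "[Le, La, Lc, Ld, La]" "?q @ H b"] by simp
  ultimately show ?thesis using that by blast
qed

section \<open>Desubstitution of conjugacy classes\<close>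

text \<open>Dropping the last letter makes the condition stable under desubstitution: the image
  \<open>[D2]\<close> of \<open>D1\<close> is a prefix of other images, so full conjugates would not lift.\<close>

definition nearly_contained :: "digit list \<Rightarrow> bool" where
  "nearly_contained v \<longleftrightarrow> (\<forall>v'. conjugate v v' \<longrightarrow> factor_x (butlast v'))"

lemma nearly_contained_conjugate: "conjugate v v' \<Longrightarrow> nearly_contained v \<Longrightarrow> nearly_contained v'"
  unfolding nearly_contained_def using conjugate_trans by blast

text \<open>If the last letter \<open>c\<close> of a conjugate is not 1, its shortened block still
  begins with 0 or 2 and marks the end of \<open>F z\<close>. For \<open>c = D1\<close> nothing of
  the block remains, and the last letter of \<open>z\<close> is recovered from its own
  block.\<close>

lemma nearly_contained_F:
  assumes "nearly_contained (F v)"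
  shows "nearly_contained v"
  unfolding nearly_contained_def
proof (intro allI impI)
  fix v' assume v': "conjugate v v'"
  show "factor_x (butlast v')"
  proof (cases v' rule: rev_cases)
    case (snoc z c)
    have near: "factor_x (butlast w)" if "conjugate (F v') w" for w
      using assms that conjugate_morphism[OF v'] conjugate_trans unfolding nearly_contained_def by blast
    show ?thesis
    proof (cases "c = D1")
      case False
      define r where "r = butlast (F_letter c)"
      have r: "starts_F r" "butlast (F v') = F z @ r"
        using snoc False by (cases c; simp add: r_def butlast_append)+
      then have "factor_x ([] @ F z @ r)" using near[of "F v'"] by simp
      then obtain z1 z2 where "factor_x (z1 @ z @ z2)" by (rule factor_x_F_decode[OF _ r(1)])
      then show ?thesis using snoc factor_x_sublist by fastforce
    next
      case c: True
      show ?thesis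
      proof (cases z rule: rev_cases)
        case z: (snoc y l)
        have Fy: "factor_x (F y @ F_letter l)" using near[of "F v'"] snoc c z by (simp add: butlast_append)
        show ?thesis
        proof (cases "l = D1")
          case False
          then have l: "starts_F (F_letter l)" by (cases l) auto
          obtain z1 z2 where z12: "factor_x (z1 @ y @ z2)" "prefix (F_letter l) (F z2)"
            by (rule factor_x_F_decode[of "[]" y, OF _ l]) (use Fy in simp_all)
          then obtain d z3 where d: "z2 = d # z3" using False by (cases z2; cases l) auto
          have "F z3 = [] \<or> starts_F (F z3)" by (cases "z3 = []") (simp_all add: starts_F_F)
          \<comment> \<open>The block of \<open>l\<close> has two letters, and after
            \<open>F(1) = 2\<close> no image can supply a 3 or 4.\<close>
          then have "d = l"
            using z12(2) False unfolding d by (cases l; cases d; auto simp: prefix_def)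
          then have "sublist z (z1 @ y @ z2)"
            unfolding z d sublist_def by (metis append.assoc append_Cons append_Nil)
          then show ?thesis using snoc z12(1) factor_x_sublist by simp
        next
          case True
          show ?thesis
          proof (cases "y = []")
            case True
            then have "sublist z ((F ^^ 1) [D0])" using z \<open>l = D1\<close> by (simp add: sublist_Cons_right)
            then show ?thesis unfolding snoc factor_x_def by (metis butlast_snoc)
          next
            case False
            then have "F y \<noteq> []" using starts_F_F by force
            \<comment> \<open>Here the conjugate ends in 11; its image 22, rotated to the front,
              survives \<open>butlast\<close>.\<close>
            moreover have "conjugate (F v') ([D2, D2] @ F y)"
              using conjugate_append[of "F y" "[D2, D2]"] snoc c z \<open>l = D1\<close> by simp
            ultimately have "factor_x ([] @ [D2, D2] @ butlast (F y))"
              using near[of "[D2, D2] @ F y"] by simp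
            then show ?thesis
              using not_factor_x[of "[D2, D2]" "[]"] by (simp add: non_factors_def)
          qed
        qed
      qed (simp add: snoc)
    qed
  qed simp
qed

lemma F_block:
  assumes "factor_x (A @ B)" "starts_F (A @ B)" "starts_F B"
  obtains y where "A = F y"
proof -
  obtain z where "factor_x z" "sublist (A @ B) (F z)"
    using factor_xE[OF assms(1)] .
  then obtain p s where z: "F z = p @ A @ B @ s" by (auto simp: sublist_def)
  have "starts_F (A @ B @ s)" "starts_F (B @ s)"
    using starts_F_append[OF assms(2)] starts_F_append[OF assms(3)] by simp_all
  then show thesis using F_sync[OF z] F_sync that by metis
qed

text \<open>Blocks of \<open>F\<close> have at most two letters, so one of two adjacent positions is
  a boundary.\<close>

lemma starts_F_near:
  assumes "factor_x (a # b # s)"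
  shows "starts_F [a] \<or> starts_F [b]"
  using assms not_factor_x[of "[a, b]" "[]" s]
  by (cases a; cases b) (auto simp: non_factors_def)

text \<open>If \<open>v\<close> is conjugate to \<open>A @ B\<close> with block boundaries before both \<open>A\<close> and \<open>B\<close>, then the
  conjugate \<open>A @ B\<close> shows that \<open>A\<close> is an image, and the conjugate \<open>B @ A\<close> that \<open>B\<close> is one.\<close>

lemma nearly_contained_desubstitute:
  assumes "nearly_contained v" "5 \<le> length v"
  obtains v' where "conjugate v (F v')"
proof -
  have "\<exists>t. conjugate v t \<and> starts_F t"
  proof -
    obtain a b s where v: "v = a # b # s" "s \<noteq> []"
      using assms(2) by (cases v; cases "tl v"; cases "tl (tl v)") auto
    then have "starts_F [a] \<or> starts_F [b]"
      using assms(1) starts_F_near[of a b "butlast s"] unfolding nearly_contained_def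
      by (metis butlast.simps(2) conjugate_refl list.distinct(1))
    then show ?thesis
    proof
      assume "starts_F [a]"
      then show ?thesis using v by (intro exI[of _ v]) auto
    next
      assume "starts_F [b]"
      then show ?thesis
        using v conjugate_append[of "[a]" "b # s"] by (intro exI[of _ "b # s @ [a]"]) auto
    qed
  qed
  then obtain t where t: "conjugate v t" "starts_F t" by blast
  have near: "factor_x (butlast w)" if "conjugate t w" for w
    using assms(1) t(1) that conjugate_trans unfolding nearly_contained_def by blast
  have "length t \<ge> 5" using assms(2) t(1) conjugate_length by metis
  then obtain a b c d e s where abc: "t = a # b # c # d # e # s"
    by (auto simp: numeral_eq_Suc Suc_le_length_iff)
  \<comment> \<open>The second boundary is sought at the third or fourth letter: both arcs then have
    at least two letters, and \<open>butlast\<close> leaves their first letters in place.\<close>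
  have "butlast t = [a, b] @ [c, d] @ butlast (e # s)" using abc by simp
  then have "factor_x [c, d]" using near[of t] factor_x_sublist by (metis conjugate_refl sublist_appendI)
  then have "starts_F [c] \<or> starts_F [d]" by (rule starts_F_near)
  then obtain A B where AB: "t = A @ B" "starts_F B" "2 \<le> length A" "2 \<le> length B"
  proof
    assume "starts_F [c]"
    then show ?thesis using that[of "[a, b]" "c # d # e # s"] abc by auto
  next
    assume "starts_F [d]"
    then show ?thesis using that[of "[a, b, c]" "d # e # s"] abc by auto
  qed
  have sA: "starts_F A" using AB t(2) by (cases A) auto
  have butlast: "starts_F (butlast w)" if "starts_F w" "2 \<le> length w" for w
    using that by (cases w; cases "tl w") auto
  obtain y1 where "A = F y1"
  proof (rule F_block[of A "butlast B"])
    show "factor_x (A @ butlast B)" using near[of t] AB by (auto simp: butlast_append split: if_splits)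
  qed (use AB sA butlast starts_F_append in auto)
  moreover obtain y2 where "B = F y2"
  proof (rule F_block[of B "butlast A"])
    show "factor_x (B @ butlast A)"
      using near[of "B @ A"] conjugate_append[of A B] AB by (auto simp: butlast_append split: if_splits)
  qed (use AB sA butlast starts_F_append in auto)
  ultimately show thesis using that[of "y1 @ y2"] AB t(1) by simp
qed

text \<open>The surviving classes are \<open>F(F(0)) = 012\<close>, \<open>F(F(2)) = 0124\<close>,
  \<open>F(F(4)) = 0324\<close> and the exceptional 203.\<close>

lemma short_nearly_contained:
  "\<forall>m\<in>set [3, 4]. \<forall>v\<in>set (List.n_lists m [D0, D1, D2, D3, D4]).
     (\<exists>i\<in>set [0..<m]. \<exists>y\<in>set non_factors. prefix y (butlast (rotate i v))) \<or>
     (\<exists>i\<in>set [0..<m]. rotate i v \<in> set [[D0,D1,D2],[D2,D0,D3],[D0,D1,D2,D4],[D0,D3,D2,D4]])"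
  by code_simp

lemma length_F_le: "length (F y) \<le> 2 * length y"
proof (induction y)
  case (Cons c y)
  then show ?case by (cases c) auto
qed simp

text \<open>Makes desubstitution decrease the length: only 1 has an image of length one, and 11 is
  not a factor.\<close>

lemma length_F_strict:
  assumes "nearly_contained v" "3 \<le> length v"
  shows "length v < length (F v)"
proof -
  obtain a b s where v: "v = a # b # s" "s \<noteq> []"
    using assms(2) by (cases v; cases "tl v"; cases "tl (tl v)") auto
  have "factor_x (a # b # butlast s)"
    using assms(1) v unfolding nearly_contained_def
    by (metis butlast.simps(2) conjugate_refl list.distinct(1))
  then have "\<not> (a = D1 \<and> b = D1)"
    using not_factor_x[of "[D1, D1]" "[]" "butlast s"] by (auto simp: non_factors_def)
  then show ?thesis using length_F[of s] v by (cases a; cases b) auto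
qed

lemma nearly_contained_obstructed:
  "nearly_contained v \<Longrightarrow> 3 \<le> length v \<Longrightarrow> obstructed v \<or> conjugate v [D2, D0, D3]"
proof (induction "length v" arbitrary: v rule: less_induct)
  case less
  show ?case
  proof (cases "length v \<le> 4")
    case True
    have "\<not> prefix y (butlast (rotate i v))" if "y \<in> set non_factors" for i y
    proof
      assume "prefix y (butlast (rotate i v))"
      then obtain s where "butlast (rotate i v) = [] @ y @ s" by (auto simp: prefix_def)
      moreover have "factor_x (butlast (rotate i v))"
        using less.prems(1) unfolding nearly_contained_def conjugate_rotate by blast
      ultimately show False using not_factor_x[OF that] by metis
    qed
    moreover have "v \<in> set (List.n_lists (length v) [D0, D1, D2, D3, D4])"
      using digit.exhaust by (auto simp: set_n_lists)
    moreover have "length v \<in> set [3, 4]" using True less.prems by auto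
    ultimately obtain i where
      "rotate i v \<in> set [[D0,D1,D2],[D2,D0,D3],[D0,D1,D2,D4],[D0,D3,D2,D4]]"
      using short_nearly_contained by blast
    moreover have "obstructed [D0,D1,D2]" "obstructed [D0,D1,D2,D4]" "obstructed [D0,D3,D2,D4]"
      using obstructed_F[OF obstructed_F[OF obstructed_letter[of D0]]]
        obstructed_F[OF obstructed_F[OF obstructed_letter[of D2]]]
        obstructed_F[OF obstructed_F[OF obstructed_letter[of D4]]] by simp_all
    moreover have "conjugate v (rotate i v)" unfolding conjugate_rotate by blast
    ultimately show ?thesis using obstructed_conjugate by auto
  next
    case False
    then obtain v' where v': "conjugate v (F v')"
      using nearly_contained_desubstitute less.prems(1) False by fastforce
    have near: "nearly_contained (F v')" using nearly_contained_conjugate[OF v' less.prems(1)] .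
    note near' = nearly_contained_F[OF near]
    have len: "length v = length (F v')" using conjugate_length[OF v'] by simp
    have 3: "3 \<le> length v'" using len False length_F_le[of v'] by simp
    then have "obstructed v' \<or> conjugate v' [D2, D0, D3]"
      using less.hyps near' len length_F_strict by metis
    then show ?thesis
    proof
      assume "obstructed v'"
      then show ?thesis using obstructed_F obstructed_conjugate v' by blast
    next
      assume "conjugate v' [D2, D0, D3]"
      \<comment> \<open>The exceptional class does not propagate: a conjugate of its image contains
        the non-factor 4030 before its last letter.\<close>
      then have "conjugate (F v') ([D0,D3,D0,D1] @ [D2,D4])"
        using conjugate_morphism[of v' "[D2, D0, D3]" F_letter] by simp
      then have "conjugate (F v') [D2,D4,D0,D3,D0,D1]" using conjugate_rotateI by fastforce
      then have "factor_x ([D2] @ [D4,D0,D3,D0] @ [])"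
        using near unfolding nearly_contained_def by fastforce
      then show ?thesis using not_factor_x[of "[D4,D0,D3,D0]" "[D2]" "[]"] by (simp add: non_factors_def)
    qed
  qed
qed

section \<open>From words over five letters back to digits\<close>

definition factors10 :: "letter list list" where
 "factors10 = [[La,Lb,Lc,Ld,Lb,Le,Lc,Ld,La,Lb], [La,Lb,Lc,Ld,Lb,Le,Lc,Ld,Le,La],
   [La,Lb,Lc,Ld,Le,La,Lc,Ld,La,Lb], [La,Lb,Lc,Ld,Le,La,Lc,Ld,Lb,Le],
   [La,Lc,Ld,La,Lb,Lc,Ld,Lb,Le,Lc], [La,Lc,Ld,Lb,Le,La,Lb,Lc,Ld,Lb],
   [La,Lc,Ld,Lb,Le,La,Lb,Lc,Ld,Le], [La,Lc,Ld,Lb,Le,Lc,Ld,La,Lb,Lc],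
   [Lb,Lc,Ld,Lb,Le,Lc,Ld,La,Lb,Lc], [Lb,Lc,Ld,Lb,Le,Lc,Ld,Le,La,Lc],
   [Lb,Lc,Ld,Le,La,Lc,Ld,La,Lb,Lc], [Lb,Lc,Ld,Le,La,Lc,Ld,Lb,Le,La],
   [Lb,Le,La,Lb,Lc,Ld,Lb,Le,Lc,Ld], [Lb,Le,La,Lb,Lc,Ld,Le,La,Lc,Ld],
   [Lb,Le,Lc,Ld,La,Lb,Lc,Ld,Le,La], [Lb,Le,Lc,Ld,Le,La,Lc,Ld,Lb,Le],
   [Lc,Ld,La,Lb,Lc,Ld,Lb,Le,Lc,Ld], [Lc,Ld,La,Lb,Lc,Ld,Le,La,Lc,Ld],
   [Lc,Ld,Lb,Le,La,Lb,Lc,Ld,Lb,Le], [Lc,Ld,Lb,Le,La,Lb,Lc,Ld,Le,La],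
   [Lc,Ld,Lb,Le,Lc,Ld,La,Lb,Lc,Ld], [Lc,Ld,Lb,Le,Lc,Ld,Le,La,Lc,Ld],
   [Lc,Ld,Le,La,Lc,Ld,La,Lb,Lc,Ld], [Lc,Ld,Le,La,Lc,Ld,Lb,Le,La,Lb],
   [Lc,Ld,Le,La,Lc,Ld,Lb,Le,Lc,Ld], [Ld,La,Lb,Lc,Ld,Lb,Le,Lc,Ld,La],
   [Ld,La,Lb,Lc,Ld,Lb,Le,Lc,Ld,Le], [Ld,La,Lb,Lc,Ld,Le,La,Lc,Ld,La],
   [Ld,La,Lb,Lc,Ld,Le,La,Lc,Ld,Lb], [Ld,Lb,Le,La,Lb,Lc,Ld,Lb,Le,Lc],
   [Ld,Lb,Le,La,Lb,Lc,Ld,Le,La,Lc], [Ld,Lb,Le,Lc,Ld,La,Lb,Lc,Ld,Le],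
   [Ld,Lb,Le,Lc,Ld,Le,La,Lc,Ld,Lb], [Ld,Le,La,Lc,Ld,La,Lb,Lc,Ld,Lb],
   [Ld,Le,La,Lc,Ld,Lb,Le,La,Lb,Lc], [Ld,Le,La,Lc,Ld,Lb,Le,Lc,Ld,La],
   [Le,La,Lb,Lc,Ld,Lb,Le,Lc,Ld,Le], [Le,La,Lb,Lc,Ld,Le,La,Lc,Ld,La],
   [Le,La,Lc,Ld,La,Lb,Lc,Ld,Lb,Le], [Le,La,Lc,Ld,Lb,Le,La,Lb,Lc,Ld],
   [Le,La,Lc,Ld,Lb,Le,Lc,Ld,La,Lb], [Le,Lc,Ld,La,Lb,Lc,Ld,Le,La,Lc],
   [Le,Lc,Ld,Le,La,Lc,Ld,Lb,Le,La], [Le,Lc,Ld,Le,La,Lc,Ld,Lb,Le,Lc]]"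

lemma windows_H_factors5: "\<forall>W\<in>set factors5. \<forall>y\<in>set (windows 10 (H W)). y \<in> set factors10"
  by code_simp

lemma factor_w_factors10:
  assumes "factor_w u" "length u = 10"
  shows "u \<in> set factors10"
proof -
  obtain W where W: "W \<in> set factors5" "sublist u (H W)"
    using factor_w_factors5 assms by fastforce
  have "4 * length y \<le> length (H y)" for y
  proof (induction y)
    case (Cons c y)
    then show ?case by (cases c) auto
  qed simp
  from this[of W] have "10 \<le> length (H W)" using length_factors5[OF W(1)] by simp
  then obtain v where v: "v \<in> set (windows 10 (H W))" "sublist u v"
    using sublist_windowsE[of u "H W" 10] W(2) assms(2) by auto
  then have "length v = 10" by (auto simp: windows_def)
  then have "u = v" using v(2) assms(2) by (auto simp: sublist_def)
  then show ?thesis using v W windows_H_factors5 by blast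
qed

section \<open>Conjugacy classes of length at most ten\<close>

lemma short_conjugacy_classes:
  "\<forall>k\<in>set [2..<11]. let T = map (take k) factors10 in
     \<forall>y\<in>set factors10. \<exists>i\<in>set [1..<k]. rotate i (take k y) \<notin> set T"
  by code_simp

text \<open>Factors extend to the right, so all factors of length \<open>k\<close> are prefixes of
  words in \<open>factors10\<close>; a finite search finds a rotation that is not.\<close>

lemma avoids_short:
  assumes "2 \<le> length u" "length u \<le> 10"
  shows "avoids_conjugacy_class w5 u"
proof -
  have *: "v \<in> take (length u) ` set factors10" if v: "factor v w5" "length v = length u" for v
  proof -
    obtain t where "length t = 10 - length u" "factor_w (v @ t)"
      using factor_w5_extend[OF v(1)] .
    then have "v @ t \<in> set factors10" using factor_w_factors10 v(2) assms(2) by simp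
    then show ?thesis using v(2) by (intro image_eqI[of _ _ "v @ t"]) auto
  qed
  show ?thesis
  proof (cases "factor u w5")
    case True
    then obtain y where y: "y \<in> set factors10" "u = take (length u) y" using *[of u] by (metis imageE)
    have "length u \<in> set [2..<11]" using assms by auto
    then obtain i where "rotate i (take (length u) y) \<notin> set (map (take (length u)) factors10)"
      using short_conjugacy_classes y(1) unfolding Let_def by blast
    then have "rotate i u \<notin> take (length u) ` set factors10" using y(2) by simp
    then have "\<not> factor (rotate i u) w5" using *[of "rotate i u"] by auto
    then show ?thesis
      unfolding avoids_conjugacy_class_def contains_conjugacy_class_def conjugate_rotate by blast
  next
    case False
    then show ?thesis
      unfolding avoids_conjugacy_class_def contains_conjugacy_class_def using conjugate_refl by blast
  qed
qed

section \<open>Longer conjugacy classes\<close>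

definition non_factors_w :: "letter list list" where
  "non_factors_w = [[Le, Le],
    [Lb, Lc, Ld, La],
    [La, Lc, Ld, Le],
    [Le, Lc, Ld, La, Lb, Lc, Ld, Lb],
    [La, Lc, Ld, Lb, Le, Lc, Ld, Le],
    [Le, Lc, Ld, Le, La, Lc, Ld, La],
    [Lb, Lc, Ld, Le, La, Lc, Ld, Lb, Le, Lc],
    [Le, La, Lb, Lc, Ld, Lb, Le, Lc, Ld, La]]"

lemma not_factor_w:
  assumes "y \<in> set non_factors_w"
  shows "\<not> factor_w (y @ s)"
proof -
  have "\<forall>y\<in>set non_factors_w. length y \<le> 17 \<and> (\<forall>W\<in>set factors5. \<not> sublist y (H W))"
    by code_simp
  then show ?thesis
    using assms by (metis factor_w_factors5 factor_w_sublist sublist_append_rightI)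
qed

text \<open>Settles 203 and all two-letter classes except those of 01, 03, 24 and 23. The longest
  image, \<open>H(203)\<close>, has length 18, so all rotations are covered.\<close>

lemma H_short_obstructed:
  "\<forall>v\<in>set [[D0,D0],[D1,D1],[D2,D2],[D3,D3],[D4,D4],[D0,D2],[D0,D4],[D1,D2],[D1,D3],[D1,D4],[D3,D4],[D2,D0,D3]].
     \<exists>i\<in>set [0..<18]. \<exists>y\<in>set non_factors_w. prefix y (rotate i (H v))"
  by code_simp

text \<open>These are the boundary marks of \<open>starts_H\<close> that need no left
  context.\<close>

definition has_start :: "letter list \<Rightarrow> bool" where
  "has_start y \<longleftrightarrow> sublist [La, Lb] y \<or> sublist [Le, La, Lc] y"

lemma factors10_has_start: "\<forall>y\<in>set factors10. has_start y"
  by code_simp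

lemma has_startE:
  assumes "has_start y"
  obtains p s where "y = p @ s" "starts_H [] s"
proof -
  obtain m where "sublist m y" and m: "m = [La, Lb] \<or> m = [Le, La, Lc]"
    using assms unfolding has_start_def by blast
  then obtain p s where "y = p @ m @ s" by (auto simp: sublist_def)
  then show thesis using that[of p "m @ s"] m by (auto simp: starts_H_def)
qed

lemma factor_w_starts_H:
  assumes "factor_w w" "10 \<le> length w"
  obtains p s where "w = p @ s" "starts_H [] s"
proof -
  have "take 10 w \<in> set factors10"
    using assms factor_w_sublist by (intro factor_w_factors10) auto
  then obtain p s where "take 10 w = p @ s" "starts_H [] s"
    using factors10_has_start has_startE by blast
  then show thesis
    using that[of p "s @ drop 10 w"] starts_H_mono[of "[]" s "[]"]
    by (metis append.assoc append_Nil append_take_drop_id)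
qed

lemma H_block:
  assumes "factor_w (A @ B)" "starts_H [] (A @ B)" "starts_H [] B"
  obtains y where "A = H y"
proof -
  obtain z p s where z: "H z = p @ A @ B @ s"
    using assms(1) by (auto simp: factor_w_def sublist_def)
  have s: "starts_H p (A @ B @ s)" "starts_H q (B @ s)" for q
    using starts_H_mono[OF assms(2), of p s] starts_H_mono[OF assms(3), of q s] by simp_all
  obtain z1 z2 where "H z2 = A @ B @ s" using H_sync[OF z s(1)] .
  then obtain z3 where "H z3 = A" using H_sync[OF _ s(2)] by metis
  then show thesis using that by blast
qed

definition conjugates_in_w :: "letter list \<Rightarrow> bool" where
  "conjugates_in_w u \<longleftrightarrow> (\<forall>v. conjugate u v \<longrightarrow> factor_w v)"

text \<open>After rotating to a boundary, the first letter is set aside and the remaining ten or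
  more letters contain a second boundary. Both arcs are nonempty images, so \<open>v\<close> has at
  least two letters.\<close>

lemma conjugates_in_w_desubstitute:
  assumes "conjugates_in_w u" "11 \<le> length u"
  obtains v where "conjugate u (H v)" "2 \<le> length v"
proof -
  have "factor_w u" using assms(1) conjugate_refl unfolding conjugates_in_w_def by blast
  then obtain p s where ps: "u = p @ s" "starts_H [] s"
    by (rule factor_w_starts_H) (use assms(2) in simp)
  define t where "t = s @ p"
  have t: "conjugate u t" "starts_H [] t" "length t = length u"
    using ps conjugate_append starts_H_mono[of "[]" s "[]" p] by (auto simp: t_def)
  have fac: "factor_w w" if "conjugate t w" for w
    using assms(1) t(1) that conjugate_trans unfolding conjugates_in_w_def by blast
  obtain c t' where t': "t = c # t'" using t assms(2) by (cases t) auto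
  have "factor_w t'" using fac[OF conjugate_refl] t' factor_w_sublist[of t t'] by (simp add: sublist_Cons_right)
  then obtain A B where AB: "t' = A @ B" "starts_H [] B"
    by (rule factor_w_starts_H) (use t' t(3) assms(2) in simp)
  obtain y1 where y1: "c # A = H y1"
    using H_block[of "c # A" B] fac[of t] t t' AB by auto
  then have "y1 \<noteq> []" by auto
  \<comment> \<open>The lookahead in \<open>t\<close> might have run into \<open>B\<close>; as a
    nonempty image, \<open>c # A\<close> contains it.\<close>
  then have "starts_H [] (c # A)" using H_hd[of y1] y1 by (auto simp: starts_H_def)
  then obtain y2 where y2: "B = H y2"
    using H_block[of B "c # A"] fac[of "B @ c # A"] conjugate_append[of "c # A" B] t' AB
      starts_H_mono[of "[]" B "[]"] by auto
  then have "y2 \<noteq> []" using AB by (auto simp: starts_H_def)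
  then have "2 \<le> length (y1 @ y2)" using \<open>y1 \<noteq> []\<close> by (cases y1; cases y2) auto
  moreover have "t = H (y1 @ y2)" using t' AB y1 y2 by (metis append_Cons morphism_simps(3))
  ultimately show thesis using that t(1) by blast
qed

text \<open>The block of the last letter marks the end of \<open>H z\<close>, but may be a prefix of
  another block, so only \<open>z\<close> is recovered.\<close>

lemma conjugates_in_w_H:
  assumes "conjugates_in_w (H v)"
  shows "nearly_contained v"
  unfolding nearly_contained_def
proof (intro allI impI)
  fix v' assume v': "conjugate v v'"
  show "factor_x (butlast v')"
  proof (cases v' rule: rev_cases)
    case (snoc z c)
    have "factor_w (H v')" using assms conjugate_morphism[OF v'] unfolding conjugates_in_w_def by blast
    then have "factor_w ([] @ H z @ H_letter c)" using snoc by simp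
    moreover have "starts_H [] (H z @ H_letter c)"
      using H_hd[of "z @ [c]"] by (auto simp: starts_H_def)
    moreover have "starts_H ([] @ H z) (H_letter c)" by (cases c) (auto simp: starts_H_def)
    ultimately obtain z1 z2 where "factor_x (z1 @ z @ z2)" by (rule factor_w_H_decode)
    then show ?thesis using snoc factor_x_sublist by fastforce
  qed simp
qed

lemma not_conjugates_in_w:
  assumes "11 \<le> length u"
  shows "\<not> conjugates_in_w u"
proof
  assume u: "conjugates_in_w u"
  obtain v where v: "conjugate u (H v)" "2 \<le> length v"
    using conjugates_in_w_desubstitute[OF u assms] .
  have fac: "factor_w w" if "conjugate (H v) w" for w
    using u v(1) that conjugate_trans unfolding conjugates_in_w_def by blast
  then have near: "nearly_contained v" by (intro conjugates_in_w_H) (simp add: conjugates_in_w_def)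
  have not_obstructed: "\<not> obstructed v" using obstructed_H fac by blast
  have bad: "v' \<notin> set [[D0,D0],[D1,D1],[D2,D2],[D3,D3],[D4,D4],[D0,D2],[D0,D4],[D1,D2],[D1,D3],[D1,D4],[D3,D4],[D2,D0,D3]]"
    if v': "conjugate v v'" for v'
  proof
    assume "v' \<in> set [[D0,D0],[D1,D1],[D2,D2],[D3,D3],[D4,D4],[D0,D2],[D0,D4],[D1,D2],[D1,D3],[D1,D4],[D3,D4],[D2,D0,D3]]"
    then obtain i y where "y \<in> set non_factors_w" "prefix y (rotate i (H v'))"
      using H_short_obstructed by blast
    moreover have "factor_w (rotate i (H v'))"
      using fac conjugate_trans[OF conjugate_morphism[OF v']] conjugate_rotate by blast
    ultimately show False using not_factor_w by (auto simp: prefix_def)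
  qed
  show False
  proof (cases "length v = 2")
    case True
    then obtain a b where ab: "v = [a, b]" by (auto simp: numeral_eq_Suc length_Suc_conv)
    have ba: "conjugate v [b, a]" using conjugate_append[of "[a]" "[b]"] ab by simp
    \<comment> \<open>01, 03, 24 and 23 are images of single letters; the other two-letter classes
      are in the list refuted by \<open>bad\<close>.\<close>
    have "obstructed (F [c])" if "c \<noteq> D1" for c using obstructed_F obstructed_letter that by blast
    from this[of D0] this[of D2] this[of D3] this[of D4]
    have "[a, b] \<notin> set [[D0,D1],[D0,D3],[D2,D4],[D2,D3]]" "[b, a] \<notin> set [[D0,D1],[D0,D3],[D2,D4],[D2,D3]]"
      using not_obstructed obstructed_conjugate[OF ba] ab by auto
    then show False using bad[of "[a, b]"] bad[OF ba] ab by (cases a; cases b) auto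
  next
    case False
    then have "conjugate v [D2, D0, D3]"
      using nearly_contained_obstructed[OF near] not_obstructed v(2) by simp
    then show False using bad by fastforce
  qed
qed

theorem theorem1:
  fixes u :: "letter list"
  assumes "length u \<ge> 2"
  shows "avoids_conjugacy_class w5 u"
proof (cases "length u \<le> 10")
  case False
  then have "\<not> conjugates_in_w u" by (intro not_conjugates_in_w) simp
  then show ?thesis
    unfolding avoids_conjugacy_class_def contains_conjugacy_class_def conjugates_in_w_def
    using factor_w5 by blast
qed (rule avoids_short[OF assms])

end
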